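(* Let $n\ge 1$. The following statements hold. (i) (Lower and upper bounds) For any sampling $\hat S$ of $[n]$, $$\frac{\mathbf{E}[|\hat S|^2]}{n}\le\lambda(\hat S)\le \mathbf{E}[|\hat S|].$$ (ii) (Sharper upper bound) If $\hat S$ is uniform and $|\hat S|\le\tau$ with probability one, then $$\lambda(\hat S)\le\frac{\mathbf{E}[|\hat S|]\,\tau}{n}.$$ (iii) (Identity) If $\hat S$ is uniform and $|\hat S|=\tau$ with probability one, then $\lambda(\hat S)=\tau^2/n$.
   Context: Let $[n]=\{1,\dots,n\}$. A sampling $\hat S$ is a random subset of $[n]$. It is uniform if $\mathbf{P}(i\in\hat S)=\mathbf{P}(j\in\hat S)$ for all $i,j\in[n]$. Its probability matrix is the $n\times n$ positive semidefinite matrix $P(\hat S)$ with entries $P(\hat S)_{ij}=\mathbf{P}(\{i,j\}\subseteq\hat S)$. $\lambda(\hat S)$ denotes the largest eigenvalue of $P(\hat S)$, i.e. $\lambda(\hat S)=\max_{h\in\mathbb{R}^n}\{h^\top P(\hat S)h: h^\top h\le 1\}$. *)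

theory Defs
  imports "HOL-Probability.Probability" "Jordan_Normal_Form.Spectral_Radius"
begin

text \<open>A sampling of \<open>[n] = {1..n}\<close> is a random variable, on an arbitrary probability space,
  with values in the (finite, discrete) set of subsets of \<open>{1..n}\<close>.\<close>

definition sampling :: "nat \<Rightarrow> 'w measure \<Rightarrow> ('w \<Rightarrow> nat set) \<Rightarrow> bool" where
  "sampling n M S \<longleftrightarrow> prob_space M \<and> S \<in> M \<rightarrow>\<^sub>M count_space (Pow {1..n})"

definition uniform_sampling :: "nat \<Rightarrow> 'w measure \<Rightarrow> ('w \<Rightarrow> nat set) \<Rightarrow> bool" where
  "uniform_sampling n M S \<longleftrightarrow> sampling n M S \<and>
     (\<forall>i\<in>{1..n}. \<forall>j\<in>{1..n}. \<P>(w in M. i \<in> S w) = \<P>(w in M. j \<in> S w))"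

text \<open>Matrix indices start at 0, so the entry at position \<open>(i, j)\<close> belongs to the pair
  \<open>i + 1, j + 1\<close> of elements of \<open>{1..n}\<close>.\<close>

definition prob_matrix :: "nat \<Rightarrow> 'w measure \<Rightarrow> ('w \<Rightarrow> nat set) \<Rightarrow> real mat" where
  "prob_matrix n M S = mat n n (\<lambda>(i, j). \<P>(w in M. {i + 1, j + 1} \<subseteq> S w))"

text \<open>The spectrum is the set of real eigenvalues. It is finite, and for \<open>n \<ge> 1\<close> nonempty
  because the matrix is symmetric, so the maximum is attained.\<close>

definition max_eigenvalue :: "nat \<Rightarrow> 'w measure \<Rightarrow> ('w \<Rightarrow> nat set) \<Rightarrow> real" where
  "max_eigenvalue n M S = Max (spectrum (prob_matrix n M S))"

end

theory Submission
  imports Defs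
begin

text \<open>
  Write \<open>P\<close> for the probability matrix and \<open>\<lambda>\<close> for its largest eigenvalue. Linearity of
  expectation turns the quadratic form of \<open>P\<close> into a second moment,
  \<open>h\<^sup>T P h = E[(\<Sum>i\<in>S. h i)\<^sup>2]\<close> (\<open>quad_form_prob_matrix\<close>), and by the Rayleigh principle \<open>\<lambda>\<close> is
  the least constant \<open>c\<close> with \<open>h\<^sup>T P h \<le> c \<bar>h\<bar>\<^sup>2\<close> for all \<open>h\<close>. All the bounds come from this.

  The constant vector \<open>h = 1\<close> gives \<open>E[|S|\<^sup>2] \<le> \<lambda> n\<close>. For upper bounds, Cauchy--Schwarz gives
  \<open>(\<Sum>i\<in>S. h i)\<^sup>2 \<le> |S| (\<Sum>i\<in>S. (h i)\<^sup>2)\<close> pointwise. Enlarging the last sum to all indices and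
  taking expectations yields \<open>\<lambda> \<le> E[|S|]\<close>. If instead \<open>|S| \<le> \<tau>\<close>, the factor \<open>|S|\<close> can be
  replaced by \<open>\<tau>\<close>, and the expectation of the last sum is \<open>\<Sum>i. P(i \<in> S) (h i)\<^sup>2\<close>; for a uniform
  sampling each \<open>P(i \<in> S)\<close> equals \<open>E[|S|] / n\<close>, which gives \<open>\<lambda> \<le> \<tau> E[|S|] / n\<close>. When \<open>|S| = \<tau>\<close>
  almost surely, this and the lower bound are both \<open>\<tau>\<^sup>2 / n\<close>.

  The Rayleigh principle is proved variationally. The quadratic form attains its maximum \<open>\<mu>\<close> on
  the compact unit sphere (\<open>exists_Rayleigh_maximiser\<close>), a maximiser is an eigenvector for \<open>\<mu>\<close>
  (\<open>Rayleigh_maximiser_is_eigenvector\<close>), and no eigenvalue exceeds \<open>\<mu>\<close>.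
  Vectors are functions on \<open>nat\<close> of which only the values below \<open>n\<close> matter: the product topology
  then provides compactness although the dimension \<open>n\<close> is a variable. The index \<open>i\<close> of a vector
  stands for the element \<open>Suc i\<close> of the ground set.
\<close>

section \<open>The Rayleigh quotient of a real symmetric matrix\<close>

definition quad_form :: "nat \<Rightarrow> (nat \<Rightarrow> nat \<Rightarrow> real) \<Rightarrow> (nat \<Rightarrow> real) \<Rightarrow> real" where
  "quad_form n a y = (\<Sum>i<n. \<Sum>j<n. a i j * y i * y j)"

lemma quad_form_eq_inner: "quad_form n a y = (\<Sum>i<n. y i * (\<Sum>j<n. a i j * y j))"
  unfolding quad_form_def by (simp add: sum_distrib_left mult_ac)

lemma quad_form_add_scaled:
  assumes "\<And>i j. i < n \<Longrightarrow> j < n \<Longrightarrow> a i j = a j i"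
  shows "quad_form n a (\<lambda>i. x i + t * r i)
    = quad_form n a x + 2 * t * (\<Sum>i<n. r i * (\<Sum>j<n. a i j * x j)) + t\<^sup>2 * quad_form n a r"
proof -
  have swap: "(\<Sum>i<n. \<Sum>j<n. a i j * x i * r j) = (\<Sum>i<n. \<Sum>j<n. a i j * r i * x j)"
    by (subst sum.swap) (intro sum.cong refl, simp add: assms mult_ac)
  have "quad_form n a (\<lambda>i. x i + t * r i)
     = (\<Sum>i<n. \<Sum>j<n. a i j * x i * x j + t * (a i j * x i * r j)
          + t * (a i j * r i * x j) + t\<^sup>2 * (a i j * r i * r j))"
    unfolding quad_form_def by (intro sum.cong refl) (simp add: algebra_simps power2_eq_square)
  also have "\<dots> = quad_form n a x + t * (\<Sum>i<n. \<Sum>j<n. a i j * x i * r j)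
     + t * (\<Sum>i<n. \<Sum>j<n. a i j * r i * x j) + t\<^sup>2 * quad_form n a r"
    unfolding quad_form_def by (simp add: sum.distrib sum_distrib_left)
  finally show ?thesis unfolding swap by (simp add: sum_distrib_left mult_ac)
qed

lemma quad_form_scale: "quad_form n a (\<lambda>i. t * y i) = t\<^sup>2 * quad_form n a y"
  unfolding quad_form_def by (simp add: sum_distrib_left power2_eq_square mult_ac)

text \<open>First-order condition at a minimum: for small negative \<open>t\<close> the linear term dominates the
  quadratic one, so a positive \<open>c\<close> would make the expression negative.\<close>

lemma linear_coeff_nonpos:
  fixes c d :: real
  assumes "\<And>t. 0 \<le> 2 * t * c + t\<^sup>2 * d"
  shows "c \<le> 0"
proof (rule ccontr)
  assume "\<not> c \<le> 0"
  then have c: "c > 0" by simp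
  \<comment> \<open>small enough that \<open>s * d \<le> c\<close>; the \<open>+ 1\<close> covers \<open>d = 0\<close>\<close>
  define s where "s = c / (\<bar>d\<bar> + 1)"
  have s: "s > 0" using c by (simp add: s_def add_nonneg_pos)
  have "0 \<le> 2 * (- s) * c + (- s)\<^sup>2 * d" by (rule assms)
  then have "s * (2 * c) \<le> s * (s * d)" by (simp add: power2_eq_square algebra_simps)
  then have "2 * c \<le> s * d" using s by simp
  also have "s * d \<le> s * (\<bar>d\<bar> + 1)" using s by (intro mult_left_mono) auto
  also have "\<dots> = c" by (simp add: s_def add_nonneg_pos add_eq_0_iff_both_eq_0)
  finally show False using c by simp
qed

text \<open>Coordinates from \<open>n\<close> on are pinned to \<open>0\<close>, since otherwise the set would be unbounded in
  those directions. With that, the sphere is a closed subset of a product of compact sets, to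
  which the theorem of Tychonoff applies.\<close>

lemma compact_unit_sphere_fun:
  "compact {x :: nat \<Rightarrow> real. (\<forall>i\<ge>n. x i = 0) \<and> (\<Sum>i<n. (x i)\<^sup>2) = 1}" (is "compact ?S")
proof -
  define B :: "nat \<Rightarrow> real set" where "B = (\<lambda>i. if i < n then {-1..1} else {0})"
  have "compactin (product_topology (\<lambda>_. euclidean) UNIV) (PiE UNIV B)"
    by (auto simp: compactin_PiE B_def)
  then have cB: "compact (PiE UNIV B)"
    by (simp add: euclidean_product_topology)
  have cl: "closed {x :: nat \<Rightarrow> real. (\<Sum>i<n. (x i)\<^sup>2) = 1}"
    by (intro closed_Collect_eq continuous_intros continuous_on_product_coordinates)
  have "?S = PiE UNIV B \<inter> {x. (\<Sum>i<n. (x i)\<^sup>2) = 1}"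
  proof (intro Set.set_eqI iffI)
    fix x assume x: "x \<in> ?S"
    have "\<bar>x i\<bar> \<le> 1" if "i < n" for i
    proof -
      have "(x i)\<^sup>2 \<le> (\<Sum>i<n. (x i)\<^sup>2)" using that by (intro member_le_sum) auto
      then show ?thesis using x by (simp add: abs_square_le_1)
    qed
    then have "x i \<in> B i" for i
      using x by (cases "i < n") (auto simp: B_def abs_le_iff minus_le_iff)
    then have "x \<in> PiE UNIV B" by (intro PiE_I) auto
    moreover have "(\<Sum>i<n. (x i)\<^sup>2) = 1" using x by blast
    ultimately show "x \<in> PiE UNIV B \<inter> {x. (\<Sum>i<n. (x i)\<^sup>2) = 1}" by blast
  next
    fix x assume x: "x \<in> PiE UNIV B \<inter> {x. (\<Sum>i<n. (x i)\<^sup>2) = 1}"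
    have "x i = 0" if "i \<ge> n" for i
    proof -
      have "x i \<in> B i" using x by (simp add: PiE_iff)
      then show ?thesis using that by (simp add: B_def)
    qed
    then show "x \<in> ?S" using x by blast
  qed
  then show ?thesis using compact_Int_closed[OF cB cl] by simp
qed

text \<open>Both sides of the inequality are homogeneous of degree two in \<open>y\<close>, so it is enough to
  maximise on the unit sphere.\<close>

lemma exists_Rayleigh_maximiser:
  assumes "n \<ge> 1"
  shows "\<exists>x. (\<Sum>i<n. (x i)\<^sup>2) = 1 \<and>
    (\<forall>y. quad_form n a y \<le> quad_form n a x * (\<Sum>i<n. (y i)\<^sup>2))"
proof -
  define K where "K = {x :: nat \<Rightarrow> real. (\<forall>i\<ge>n. x i = 0) \<and> (\<Sum>i<n. (x i)\<^sup>2) = 1}"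
  have "(\<lambda>i. if i = 0 then 1 else 0) \<in> K"
    using assms by (auto simp: K_def if_distrib[of "\<lambda>z. z\<^sup>2"] sum.delta cong: if_cong)
  then have "K \<noteq> {}" by auto
  moreover have "continuous_on K (quad_form n a)"
    unfolding quad_form_def[abs_def]
    by (intro continuous_intros continuous_on_subset[OF continuous_on_product_coordinates]) auto
  ultimately obtain x where x: "x \<in> K" "\<And>y. y \<in> K \<Longrightarrow> quad_form n a y \<le> quad_form n a x"
    using continuous_attains_sup[of K "quad_form n a"] compact_unit_sphere_fun[of n]
    unfolding K_def by blast
  have "quad_form n a y \<le> quad_form n a x * (\<Sum>i<n. (y i)\<^sup>2)" for y
  proof (cases "(\<Sum>i<n. (y i)\<^sup>2) = 0")
    case True
    then have "\<forall>i<n. y i = 0" by (simp add: sum_nonneg_eq_0_iff)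
    then show ?thesis using True by (simp add: quad_form_def)
  next
    case False
    define N where "N = (\<Sum>i<n. (y i)\<^sup>2)"
    have N: "N > 0" using False unfolding N_def
      by (simp add: less_le sum_nonneg)
    \<comment> \<open>the normalised \<open>y\<close>, cut off at \<open>n\<close> so that it lies in \<open>K\<close>\<close>
    define z where "z = (\<lambda>i. if i < n then (1 / sqrt N) * y i else 0)"
    have "(\<Sum>i<n. (z i)\<^sup>2) = (\<Sum>i<n. (y i)\<^sup>2 / N)"
      using N by (intro sum.cong) (auto simp: z_def power_divide)
    also have "\<dots> = 1" using N by (simp add: N_def flip: sum_divide_distrib)
    finally have "z \<in> K" by (simp add: K_def z_def)
    then have "quad_form n a z \<le> quad_form n a x" by (rule x(2))
    moreover have "quad_form n a z = quad_form n a (\<lambda>i. (1 / sqrt N) * y i)"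
      by (simp add: quad_form_def z_def)
    ultimately have "quad_form n a y / N \<le> quad_form n a x"
      using N unfolding quad_form_scale by (simp add: power_divide)
    then show ?thesis using N by (simp add: N_def[symmetric] divide_le_eq)
  qed
  then show ?thesis using x(1) by (auto simp: K_def)
qed

text \<open>The form \<open>\<mu> \<bar>y\<bar>\<^sup>2 - y\<^sup>T a y\<close> is nonnegative and vanishes at \<open>x\<close>. Moving from \<open>x\<close> in the
  direction of the residual \<open>r = \<mu> x - a x\<close> changes it to first order by \<open>2 t \<bar>r\<bar>\<^sup>2\<close>, so
  minimality at \<open>x\<close> forces \<open>r = 0\<close>.\<close>

lemma Rayleigh_maximiser_is_eigenvector:
  assumes sym: "\<And>i j. i < n \<Longrightarrow> j < n \<Longrightarrow> a i j = a j i"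
    and max: "\<And>y. quad_form n a y \<le> \<mu> * (\<Sum>i<n. (y i)\<^sup>2)"
    and attained: "quad_form n a x = \<mu> * (\<Sum>i<n. (x i)\<^sup>2)"
    and "i < n"
  shows "(\<Sum>j<n. a i j * x j) = \<mu> * x i"
proof -
  define r where "r = (\<lambda>i. \<mu> * x i - (\<Sum>j<n. a i j * x j))"
  have norm: "(\<Sum>i<n. (x i + t * r i)\<^sup>2)
      = (\<Sum>i<n. (x i)\<^sup>2) + 2 * t * (\<Sum>i<n. r i * x i) + t\<^sup>2 * (\<Sum>i<n. (r i)\<^sup>2)" for t
  proof -
    have "(\<Sum>i<n. (x i + t * r i)\<^sup>2)
        = (\<Sum>i<n. (x i)\<^sup>2 + 2 * t * (r i * x i) + t\<^sup>2 * (r i)\<^sup>2)"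
      by (intro sum.cong refl) (simp add: power2_eq_square algebra_simps)
    then show ?thesis by (simp add: sum.distrib sum_distrib_left)
  qed
  have "(\<Sum>i<n. (r i)\<^sup>2) = (\<Sum>i<n. \<mu> * (r i * x i) - r i * (\<Sum>j<n. a i j * x j))"
    unfolding power2_eq_square
    by (intro sum.cong refl, subst (2) r_def) (simp add: algebra_simps)
  then have r2: "(\<Sum>i<n. (r i)\<^sup>2)
      = \<mu> * (\<Sum>i<n. r i * x i) - (\<Sum>i<n. r i * (\<Sum>j<n. a i j * x j))"
    by (simp add: sum_subtractf sum_distrib_left)
  have "0 \<le> 2 * t * (\<Sum>i<n. (r i)\<^sup>2) + t\<^sup>2 * (\<mu> * (\<Sum>i<n. (r i)\<^sup>2) - quad_form n a r)" for t
  proof -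
    have "quad_form n a (\<lambda>i. x i + t * r i)
      = quad_form n a x + 2 * t * (\<Sum>i<n. r i * (\<Sum>j<n. a i j * x j)) + t\<^sup>2 * quad_form n a r"
      by (rule quad_form_add_scaled) (rule sym)
    moreover have "2 * t * (\<Sum>i<n. (r i)\<^sup>2) = \<mu> * (2 * t * (\<Sum>i<n. r i * x i))
        - 2 * t * (\<Sum>i<n. r i * (\<Sum>j<n. a i j * x j))"
      unfolding r2 by (simp only: right_diff_distrib mult_ac)
    ultimately show ?thesis
      using max[of "\<lambda>i. x i + t * r i"] attained
      unfolding norm distrib_left right_diff_distrib mult.left_commute[of \<mu> "t\<^sup>2"] by linarith
  qed
  then have "(\<Sum>i<n. (r i)\<^sup>2) \<le> 0" by (rule linear_coeff_nonpos)
  then have "(\<Sum>i<n. (r i)\<^sup>2) = 0" by (simp add: antisym sum_nonneg)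
  then have "r i = 0" using \<open>i < n\<close> by (simp add: sum_nonneg_eq_0_iff)
  then show ?thesis by (simp add: r_def)
qed

text \<open>Translates between matrix eigenvectors and functions on indices; a nonzero vector is
  expressed by its squared norm, as this is what the Rayleigh quotient uses.\<close>

lemma mem_spectrum_iff:
  fixes A :: "real mat"
  assumes A: "A \<in> carrier_mat n n"
  shows "k \<in> spectrum A \<longleftrightarrow>
    (\<exists>x. (\<Sum>i<n. (x i)\<^sup>2) \<noteq> 0 \<and> (\<forall>i<n. (\<Sum>j<n. A $$ (i, j) * x j) = k * x i))"
    (is "_ \<longleftrightarrow> (\<exists>x. ?P x)")
proof
  have mult: "vec_index (A *\<^sub>v v) i = (\<Sum>j<n. A $$ (i, j) * vec_index v j)"
    if "v \<in> carrier_vec n" "i < n" for v i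
    using A that by (simp add: scalar_prod_def lessThan_atLeast0)
  {
    assume "k \<in> spectrum A"
    then obtain v where v: "v \<in> carrier_vec n" "v \<noteq> 0\<^sub>v n" "A *\<^sub>v v = k \<cdot>\<^sub>v v"
      using A by (auto simp: spectrum_def eigenvalue_def eigenvector_def)
    have "\<exists>i<n. vec_index v i \<noteq> 0"
      using v(1,2) by (metis carrier_vecD eq_vecI index_zero_vec)
    then have "(\<Sum>i<n. (vec_index v i)\<^sup>2) \<noteq> 0" by (auto simp: sum_nonneg_eq_0_iff)
    moreover have "(\<Sum>j<n. A $$ (i, j) * vec_index v j) = k * vec_index v i" if "i < n" for i
      using mult[OF v(1) that] v(1,3) that by simp
    ultimately show "\<exists>x. ?P x" by blast
  }
  assume "\<exists>x. ?P x"
  then obtain x where x: "?P x" by blast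
  define v where "v = Matrix.vec n x"
  have v: "v \<in> carrier_vec n" by (simp add: v_def)
  have "A *\<^sub>v v = k \<cdot>\<^sub>v v"
    using A x by (intro eq_vecI) (auto simp: mult[OF v] v_def scalar_prod_def lessThan_atLeast0)
  moreover have "v \<noteq> 0\<^sub>v n"
  proof
    assume "v = 0\<^sub>v n"
    then have "\<forall>i<n. x i = 0" unfolding v_def by (metis index_vec index_zero_vec(1))
    then show False using x by simp
  qed
  ultimately show "k \<in> spectrum A"
    using A v by (auto simp: spectrum_def eigenvalue_def eigenvector_def)
qed

text \<open>The Rayleigh principle: the largest eigenvalue is the least upper bound of the Rayleigh
  quotient. The maximal quotient \<open>q x\<close> is itself an eigenvalue, which in particular makes the
  spectrum nonempty, so that \<open>Max\<close> is meaningful.\<close>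

lemma Max_spectrum_symmetric:
  fixes A :: "real mat"
  assumes A: "A \<in> carrier_mat n n" and "n \<ge> 1"
    and sym: "\<And>i j. i < n \<Longrightarrow> j < n \<Longrightarrow> A $$ (i, j) = A $$ (j, i)"
  defines "q \<equiv> quad_form n (\<lambda>i j. A $$ (i, j))"
  shows Rayleigh_le_Max_spectrum: "q y \<le> Max (spectrum A) * (\<Sum>i<n. (y i)\<^sup>2)"
    and Max_spectrum_le: "(\<And>y. q y \<le> c * (\<Sum>i<n. (y i)\<^sup>2)) \<Longrightarrow> Max (spectrum A) \<le> c"
proof -
  obtain x where x: "(\<Sum>i<n. (x i)\<^sup>2) = 1" "\<And>y. q y \<le> q x * (\<Sum>i<n. (y i)\<^sup>2)"
    using exists_Rayleigh_maximiser[OF \<open>n \<ge> 1\<close>] unfolding q_def by blast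
  have "(\<Sum>j<n. A $$ (i, j) * x j) = q x * x i" if "i < n" for i
    using x that unfolding q_def
    by (intro Rayleigh_maximiser_is_eigenvector) (auto intro: sym)
  then have mem: "q x \<in> spectrum A"
    unfolding mem_spectrum_iff[OF A] using x(1) by (intro exI[of _ x]) auto
  have fin: "finite (spectrum A)" using card_finite_spectrum[OF A] by blast
  show "q y \<le> Max (spectrum A) * (\<Sum>i<n. (y i)\<^sup>2)"
  proof -
    have "q y \<le> q x * (\<Sum>i<n. (y i)\<^sup>2)" by (rule x(2))
    also have "\<dots> \<le> Max (spectrum A) * (\<Sum>i<n. (y i)\<^sup>2)"
      using fin mem by (intro mult_right_mono Max_ge sum_nonneg) auto
    finally show ?thesis .
  qed
  show "Max (spectrum A) \<le> c" if c: "\<And>y. q y \<le> c * (\<Sum>i<n. (y i)\<^sup>2)"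
  proof -
    have "k \<le> c" if k: "k \<in> spectrum A" for k
    proof -
      obtain h where h: "(\<Sum>i<n. (h i)\<^sup>2) \<noteq> 0"
          "\<And>i. i < n \<Longrightarrow> (\<Sum>j<n. A $$ (i, j) * h j) = k * h i"
        using k unfolding mem_spectrum_iff[OF A] by blast
      have "q h = k * (\<Sum>i<n. (h i)\<^sup>2)"
        unfolding q_def quad_form_eq_inner sum_distrib_left[of k]
        by (intro sum.cong refl) (simp add: h(2) power2_eq_square)
      then have "k * (\<Sum>i<n. (h i)\<^sup>2) \<le> c * (\<Sum>i<n. (h i)\<^sup>2)" using c[of h] by simp
      moreover have "0 < (\<Sum>i<n. (h i)\<^sup>2)" using h(1) by (simp add: less_le sum_nonneg)
      ultimately show ?thesis by simp
    qed
    then show ?thesis using fin mem by (subst Max_le_iff) auto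
  qed
qed

section \<open>The quadratic form of a probability matrix\<close>

text \<open>A sampling takes finitely many values and its codomain is discrete, so every function of it
  is measurable and bounded.\<close>

lemma sampling_integrable:
  fixes f :: "nat set \<Rightarrow> real"
  assumes "sampling n M S"
  shows "integrable M (\<lambda>w. f (S w))"
proof -
  interpret prob_space M using assms by (simp add: sampling_def)
  have S: "S \<in> M \<rightarrow>\<^sub>M count_space (Pow {1..n})" using assms by (simp add: sampling_def)
  have meas: "(\<lambda>w. f (S w)) \<in> borel_measurable M"
    by (rule measurable_compose[OF S]) simp
  have "norm (f (S w)) \<le> Max ((\<lambda>T. \<bar>f T\<bar>) ` Pow {1..n})" if "w \<in> space M" for w
    using measurable_space[OF S that] by (auto intro!: Max_ge)
  then show ?thesis by (intro integrable_const_bound[OF _ meas] AE_I2) auto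
qed

lemma sampling_prob_eq_integral:
  assumes "sampling n M S"
  shows "\<P>(w in M. Q (S w)) = (\<integral>w. of_bool (Q (S w)) \<partial>M)"
proof -
  interpret prob_space M using assms by (simp add: sampling_def)
  have "(\<integral>w. of_bool (Q (S w)) \<partial>M) = (\<integral>w. indicator {w \<in> space M. Q (S w)} w \<partial>M)"
    by (intro Bochner_Integration.integral_cong) (auto simp: indicator_def)
  also have "\<dots> = \<P>(w in M. Q (S w))"
    by (simp add: Int_absorb2 subsetI)
  finally show ?thesis by simp
qed

lemma card_eq_sum_of_bool:
  assumes "T \<subseteq> {1..n}"
  shows "real (card T) = (\<Sum>i<n. of_bool (Suc i \<in> T))"
proof -
  have "card T = card {i. i < n \<and> Suc i \<in> T}"
  proof (rule bij_betw_same_card[symmetric])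
    have "T = Suc ` {i. i < n \<and> Suc i \<in> T}"
    proof
      show "T \<subseteq> Suc ` {i. i < n \<and> Suc i \<in> T}"
      proof
        fix j assume "j \<in> T"
        then show "j \<in> Suc ` {i. i < n \<and> Suc i \<in> T}" using assms by (cases j) auto
      qed
    qed auto
    then show "bij_betw Suc {i. i < n \<and> Suc i \<in> T} T"
      by (simp add: bij_betw_def)
  qed
  also have "real \<dots> = (\<Sum>i<n. of_bool (Suc i \<in> T))"
    by (simp add: sum_of_bool_eq lessThan_def Int_def)
  finally show ?thesis .
qed

lemma sampling_subset:
  "sampling n M S \<Longrightarrow> w \<in> space M \<Longrightarrow> S w \<subseteq> {1..n}"
  unfolding sampling_def using measurable_space[of S M "count_space (Pow {1..n})" w] by simp

text \<open>The entry at \<open>(i, j)\<close> is the expectation of the product of the indicators of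
  \<open>Suc i \<in> S\<close> and \<open>Suc j \<in> S\<close>; pulling the expectation out of the double sum leaves the
  square of a single sum.\<close>

lemma quad_form_prob_matrix:
  assumes "sampling n M S"
  shows "quad_form n (\<lambda>i j. prob_matrix n M S $$ (i, j)) h
    = (\<integral>w. (\<Sum>i<n. of_bool (Suc i \<in> S w) * h i)\<^sup>2 \<partial>M)"
proof -
  have "quad_form n (\<lambda>i j. prob_matrix n M S $$ (i, j)) h
     = (\<Sum>i<n. \<Sum>j<n. (\<integral>w. of_bool ({i + 1, j + 1} \<subseteq> S w) * (h i * h j) \<partial>M))"
    unfolding quad_form_def
    using sampling_prob_eq_integral[OF assms, of "\<lambda>T. {_, _} \<subseteq> T"]
    by (intro sum.cong refl) (simp add: prob_matrix_def mult_ac)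
  also have "\<dots> = (\<integral>w. (\<Sum>i<n. \<Sum>j<n. of_bool ({i + 1, j + 1} \<subseteq> S w) * (h i * h j)) \<partial>M)"
    by (subst Bochner_Integration.integral_sum; (intro sampling_integrable[OF assms] sum.cong refl)?)
       (subst Bochner_Integration.integral_sum; (intro sampling_integrable[OF assms] refl)?)
  also have "\<dots> = (\<integral>w. (\<Sum>i<n. of_bool (Suc i \<in> S w) * h i)\<^sup>2 \<partial>M)"
    unfolding power2_eq_square sum_product
    by (intro Bochner_Integration.integral_cong sum.cong refl) (auto simp: of_bool_def)
  finally show ?thesis .
qed

text \<open>Cauchy--Schwarz against the indicator vector of \<open>T\<close>, whose squared norm is \<open>card T\<close>.
  Since the indicator is idempotent, it can be kept in the second factor as well; this
  is what makes the sharper bound for uniform samplings possible.\<close>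

lemma restricted_sum_square_le:
  assumes "T \<subseteq> {1..n}"
  shows "(\<Sum>i<n. of_bool (Suc i \<in> T) * h i)\<^sup>2
    \<le> real (card T) * (\<Sum>i<n. of_bool (Suc i \<in> T) * (h i)\<^sup>2)"
proof -
  have "(\<Sum>i<n. of_bool (Suc i \<in> T) * h i)\<^sup>2
      = (\<Sum>i<n. of_bool (Suc i \<in> T) * (of_bool (Suc i \<in> T) * h i))\<^sup>2"
    by (intro arg_cong[of _ _ "\<lambda>z. z\<^sup>2"] sum.cong) auto
  also have "\<dots> \<le> (\<Sum>i<n. (of_bool (Suc i \<in> T))\<^sup>2) * (\<Sum>i<n. (of_bool (Suc i \<in> T) * h i)\<^sup>2)"
    by (rule Cauchy_Schwarz_ineq_sum)
  also have "(\<Sum>i<n. (of_bool (Suc i \<in> T))\<^sup>2) = real (card T)"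
    unfolding card_eq_sum_of_bool[OF assms] by (intro sum.cong) auto
  also have "(\<Sum>i<n. (of_bool (Suc i \<in> T) * h i)\<^sup>2) = (\<Sum>i<n. of_bool (Suc i \<in> T) * (h i)\<^sup>2)"
    by (intro sum.cong) (auto simp: power_mult_distrib)
  finally show ?thesis .
qed

text \<open>The probabilities of the \<open>n\<close> events \<open>Suc i \<in> S\<close> sum to the expected cardinality, and here they
  are all equal.\<close>

lemma uniform_sampling_prob:
  assumes "uniform_sampling n M S" and "n \<ge> 1" and "i < n"
  shows "(\<integral>w. of_bool (Suc i \<in> S w) \<partial>M) = (\<integral>w. real (card (S w)) \<partial>M) / real n"
proof -
  have s: "sampling n M S" using assms(1) by (simp add: uniform_sampling_def)
  have eq: "(\<integral>w. of_bool (Suc j \<in> S w) \<partial>M) = ((\<integral>w. of_bool (Suc i \<in> S w) \<partial>M) :: real)"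
    if "j < n" for j
    using assms that
    unfolding uniform_sampling_def sampling_prob_eq_integral[OF s, of "\<lambda>T. _ \<in> T", symmetric]
    by auto
  have "(\<integral>w. real (card (S w)) \<partial>M) = (\<integral>w. (\<Sum>j<n. of_bool (Suc j \<in> S w)) \<partial>M)"
    by (intro Bochner_Integration.integral_cong refl card_eq_sum_of_bool sampling_subset[OF s])
  also have "\<dots> = (\<Sum>j<n. (\<integral>w. of_bool (Suc j \<in> S w) \<partial>M))"
    by (intro Bochner_Integration.integral_sum sampling_integrable[OF s])
  also have "\<dots> = real n * (\<integral>w. of_bool (Suc i \<in> S w) \<partial>M)" by (simp add: eq)
  finally show ?thesis using \<open>n \<ge> 1\<close> by simp
qed

section \<open>Bounds on the largest eigenvalue\<close>

text \<open>The Rayleigh principle for a probability matrix, with its quadratic form written as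
  a second moment.\<close>

lemma
  assumes s: "sampling n M S" and "n \<ge> 1"
  shows max_eigenvalue_ge_Rayleigh:
      "(\<integral>w. (\<Sum>i<n. of_bool (Suc i \<in> S w) * h i)\<^sup>2 \<partial>M)
        \<le> max_eigenvalue n M S * (\<Sum>i<n. (h i)\<^sup>2)"
    and max_eigenvalue_le:
      "(\<And>h. (\<integral>w. (\<Sum>i<n. of_bool (Suc i \<in> S w) * h i)\<^sup>2 \<partial>M) \<le> c * (\<Sum>i<n. (h i)\<^sup>2))
        \<Longrightarrow> max_eigenvalue n M S \<le> c"
proof -
  have carrier: "prob_matrix n M S \<in> carrier_mat n n" by (simp add: prob_matrix_def)
  have sym: "prob_matrix n M S $$ (i, j) = prob_matrix n M S $$ (j, i)" if "i < n" "j < n" for i j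
    using that by (simp add: prob_matrix_def insert_commute conj_commute)
  show "(\<integral>w. (\<Sum>i<n. of_bool (Suc i \<in> S w) * h i)\<^sup>2 \<partial>M)
        \<le> max_eigenvalue n M S * (\<Sum>i<n. (h i)\<^sup>2)"
    using Rayleigh_le_Max_spectrum[OF carrier \<open>n \<ge> 1\<close> sym]
    unfolding quad_form_prob_matrix[OF s] max_eigenvalue_def .
  show "max_eigenvalue n M S \<le> c"
    if "\<And>h. (\<integral>w. (\<Sum>i<n. of_bool (Suc i \<in> S w) * h i)\<^sup>2 \<partial>M) \<le> c * (\<Sum>i<n. (h i)\<^sup>2)"
    using Max_spectrum_le[OF carrier \<open>n \<ge> 1\<close> sym, of c] that
    unfolding quad_form_prob_matrix[OF s] max_eigenvalue_def by blast
qed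

lemma max_eigenvalue_lower_bound:
  assumes s: "sampling n M S" and "n \<ge> 1"
  shows "(\<integral>w. (real (card (S w)))\<^sup>2 \<partial>M) / real n \<le> max_eigenvalue n M S"
proof -
  have "(\<integral>w. (real (card (S w)))\<^sup>2 \<partial>M) = (\<integral>w. (\<Sum>i<n. of_bool (Suc i \<in> S w) * 1)\<^sup>2 \<partial>M)"
    by (intro Bochner_Integration.integral_cong refl)
       (simp add: card_eq_sum_of_bool[OF sampling_subset[OF s]])
  also have "\<dots> \<le> max_eigenvalue n M S * real n"
    using max_eigenvalue_ge_Rayleigh[OF assms, of "\<lambda>_. 1"] by simp
  finally show ?thesis using \<open>n \<ge> 1\<close> by (simp add: divide_le_eq)
qed

lemma max_eigenvalue_upper_bound:
  assumes s: "sampling n M S" and "n \<ge> 1"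
  shows "max_eigenvalue n M S \<le> (\<integral>w. real (card (S w)) \<partial>M)"
proof (rule max_eigenvalue_le[OF assms])
  fix h :: "nat \<Rightarrow> real"
  have "(\<integral>w. (\<Sum>i<n. of_bool (Suc i \<in> S w) * h i)\<^sup>2 \<partial>M)
      \<le> (\<integral>w. real (card (S w)) * (\<Sum>i<n. (h i)\<^sup>2) \<partial>M)"
  proof (intro integral_mono sampling_integrable[OF s])
    fix w assume "w \<in> space M"
    then have "(\<Sum>i<n. of_bool (Suc i \<in> S w) * h i)\<^sup>2
        \<le> real (card (S w)) * (\<Sum>i<n. of_bool (Suc i \<in> S w) * (h i)\<^sup>2)"
      by (intro restricted_sum_square_le sampling_subset[OF s])
    also have "\<dots> \<le> real (card (S w)) * (\<Sum>i<n. (h i)\<^sup>2)"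
      by (intro mult_left_mono sum_mono) auto
    finally show "(\<Sum>i<n. of_bool (Suc i \<in> S w) * h i)\<^sup>2
        \<le> real (card (S w)) * (\<Sum>i<n. (h i)\<^sup>2)" .
  qed
  then show "(\<integral>w. (\<Sum>i<n. of_bool (Suc i \<in> S w) * h i)\<^sup>2 \<partial>M)
      \<le> (\<integral>w. real (card (S w)) \<partial>M) * (\<Sum>i<n. (h i)\<^sup>2)" by simp
qed

lemma uniform_max_eigenvalue_upper_bound:
  assumes u: "uniform_sampling n M S" and "n \<ge> 1" and \<tau>: "AE w in M. real (card (S w)) \<le> \<tau>"
  shows "max_eigenvalue n M S \<le> (\<integral>w. real (card (S w)) \<partial>M) * \<tau> / real n"
proof -
  have s: "sampling n M S" using u by (simp add: uniform_sampling_def)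
  show ?thesis
  proof (rule max_eigenvalue_le[OF s \<open>n \<ge> 1\<close>])
    fix h :: "nat \<Rightarrow> real"
    have "(\<integral>w. (\<Sum>i<n. of_bool (Suc i \<in> S w) * h i)\<^sup>2 \<partial>M)
        \<le> (\<integral>w. \<tau> * (\<Sum>i<n. of_bool (Suc i \<in> S w) * (h i)\<^sup>2) \<partial>M)"
    proof (intro integral_mono_AE sampling_integrable[OF s])
      show "AE w in M. (\<Sum>i<n. of_bool (Suc i \<in> S w) * h i)\<^sup>2
          \<le> \<tau> * (\<Sum>i<n. of_bool (Suc i \<in> S w) * (h i)\<^sup>2)"
        using \<tau> AE_space
      proof eventually_elim
        case (elim w)
        have "(\<Sum>i<n. of_bool (Suc i \<in> S w) * h i)\<^sup>2
            \<le> real (card (S w)) * (\<Sum>i<n. of_bool (Suc i \<in> S w) * (h i)\<^sup>2)"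
          using elim by (intro restricted_sum_square_le sampling_subset[OF s])
        also have "\<dots> \<le> \<tau> * (\<Sum>i<n. of_bool (Suc i \<in> S w) * (h i)\<^sup>2)"
          using elim by (intro mult_right_mono sum_nonneg) auto
        finally show ?case .
      qed
    qed
    also have "\<dots> = \<tau> * (\<Sum>i<n. (\<integral>w. of_bool (Suc i \<in> S w) * (h i)\<^sup>2 \<partial>M))"
      by (subst Bochner_Integration.integral_sum[symmetric]) (auto intro: sampling_integrable[OF s])
    also have "\<dots> = \<tau> * (\<Sum>i<n. (\<integral>w. real (card (S w)) \<partial>M) / real n * (h i)\<^sup>2)"
      by (simp add: uniform_sampling_prob[OF u \<open>n \<ge> 1\<close>])
    also have "\<dots> = (\<integral>w. real (card (S w)) \<partial>M) * \<tau> / real n * (\<Sum>i<n. (h i)\<^sup>2)"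
      unfolding sum_distrib_left by (intro sum.cong refl) simp
    finally show "(\<integral>w. (\<Sum>i<n. of_bool (Suc i \<in> S w) * h i)\<^sup>2 \<partial>M)
        \<le> (\<integral>w. real (card (S w)) \<partial>M) * \<tau> / real n * (\<Sum>i<n. (h i)\<^sup>2)" .
  qed
qed

lemma uniform_max_eigenvalue_eq:
  assumes u: "uniform_sampling n M S" and "n \<ge> 1" and \<tau>: "AE w in M. real (card (S w)) = \<tau>"
  shows "max_eigenvalue n M S = \<tau>\<^sup>2 / real n"
proof (rule antisym)
  have s: "sampling n M S" using u by (simp add: uniform_sampling_def)
  interpret prob_space M using s by (simp add: sampling_def)
  have moment: "(\<integral>w. f (real (card (S w))) \<partial>M) = f \<tau>" for f :: "real \<Rightarrow> real"
  proof -
    have "(\<integral>w. f (real (card (S w))) \<partial>M) = (\<integral>w. f \<tau> \<partial>M)"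
      using \<tau> by (intro integral_cong_AE borel_measurable_integrable sampling_integrable[OF s]) auto
    then show ?thesis by (simp add: prob_space)
  qed
  show "\<tau>\<^sup>2 / real n \<le> max_eigenvalue n M S"
    using max_eigenvalue_lower_bound[OF s \<open>n \<ge> 1\<close>] moment[of "\<lambda>x. x\<^sup>2"] by simp
  have "AE w in M. real (card (S w)) \<le> \<tau>" using \<tau> by eventually_elim simp
  from uniform_max_eigenvalue_upper_bound[OF u \<open>n \<ge> 1\<close> this]
  show "max_eigenvalue n M S \<le> \<tau>\<^sup>2 / real n"
    using moment[of "\<lambda>x. x"] by (simp add: power2_eq_square)
qed

theorem theorem4p2:
  fixes n :: nat and M :: "'w measure" and S :: "'w \<Rightarrow> nat set"
  assumes "n \<ge> 1" and "sampling n M S"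
  shows
    "((\<integral>w. (real (card (S w)))\<^sup>2 \<partial>M) / real n \<le> max_eigenvalue n M S
        \<and> max_eigenvalue n M S \<le> (\<integral>w. real (card (S w)) \<partial>M))
     \<and> (\<forall>\<tau> :: real. uniform_sampling n M S \<and> (AE w in M. real (card (S w)) \<le> \<tau>) \<longrightarrow>
          max_eigenvalue n M S \<le> (\<integral>w. real (card (S w)) \<partial>M) * \<tau> / real n)
     \<and> (\<forall>\<tau> :: real. uniform_sampling n M S \<and> (AE w in M. real (card (S w)) = \<tau>) \<longrightarrow>
          max_eigenvalue n M S = \<tau>\<^sup>2 / real n)"
proof (intro conjI allI impI; (elim conjE)?)
  show "(\<integral>w. (real (card (S w)))\<^sup>2 \<partial>M) / real n \<le> max_eigenvalue n M S"
    by (rule max_eigenvalue_lower_bound[OF assms(2,1)])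
  show "max_eigenvalue n M S \<le> (\<integral>w. real (card (S w)) \<partial>M)"
    by (rule max_eigenvalue_upper_bound[OF assms(2,1)])
  fix \<tau> :: real
  assume u: "uniform_sampling n M S"
  show "max_eigenvalue n M S \<le> (\<integral>w. real (card (S w)) \<partial>M) * \<tau> / real n"
    if "AE w in M. real (card (S w)) \<le> \<tau>"
    by (rule uniform_max_eigenvalue_upper_bound[OF u assms(1) that])
  show "max_eigenvalue n M S = \<tau>\<^sup>2 / real n" if "AE w in M. real (card (S w)) = \<tau>"
    by (rule uniform_max_eigenvalue_eq[OF u assms(1) that])
qed

end
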